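(* Let $k_1,\ldots,k_r\in\mathbb{Z}_{\ge0}$. The function \[\eta(-k_1,\ldots,-k_r;s_1,\ldots,s_r)=\frac{1}{\prod_{j=1}^r\Gamma(s_j)}\int_0^\infty\!\!\cdots\!\int_0^\infty\prod_{j=1}^r t_j^{s_j-1}\,\frac{\mathrm{Li}^{\sqcup\!\sqcup}_{-k_1,\ldots,-k_r}(1-e^{T_1},\ldots,1-e^{T_r})}{\prod_{j=1}^r(1-e^{T_j})}\prod_{j=1}^r dt_j,\qquad T_j=\sum_{\nu=j}^r t_\nu,\] defined for $\mathrm{Re}(s_j)>0$ $(1\le j\le r)$, can be analytically continued to an entire function on $\mathbb{C}^r$, and satisfies \[\eta(-k_1,\ldots,-k_r;-m_1,\ldots,-m_r)=\mathbb{B}^{(-k_1,\ldots,-k_r)}_{m_1,\ldots,m_r}\qquad(m_1,\ldots,m_r\in\mathbb{Z}_{\ge0}).\]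
   Context: For $s_1,\ldots,s_r\in\mathbb{C}$, $\mathrm{Li}^{\sqcup\!\sqcup}_{s_1,\ldots,s_r}(z_1,\ldots,z_r)=\sum_{l_1,\ldots,l_r\ge1}\frac{z_1^{l_1}\cdots z_r^{l_r}}{l_1^{s_1}(l_1+l_2)^{s_2}\cdots(l_1+\cdots+l_r)^{s_r}}$ for $|z_j|<1$; when $s_j=-k_j$ with $k_j\in\mathbb{Z}_{\ge0}$ this is a rational function of $(z_1,\ldots,z_r)$ whose denominator is $\prod_{j=1}^r(1-z_j)^{\sum_{\nu=j}^r k_\nu+1}$, and $\mathrm{Li}^{\sqcup\!\sqcup}_{-k_1,\ldots,-k_r}(1-e^{T_1},\ldots)$ means this rational function evaluated there. Write $X_j=\sum_{\nu=j}^r x_\nu$. The numbers $\mathbb{B}^{(s_1,\ldots,s_r)}_{m_1,\ldots,m_r}$ are defined by \[\frac{\mathrm{Li}^{\sqcup\!\sqcup}_{s_1,\ldots,s_r}(1-e^{-X_1},\ldots,1-e^{-X_r})}{\prod_{j=1}^r(1-e^{-X_j})}=\sum_{m_1,\ldots,m_r\ge0}\mathbb{B}^{(s_1,\ldots,s_r)}_{m_1,\ldots,m_r}\frac{x_1^{m_1}\cdots x_r^{m_r}}{m_1!\cdots m_r!}\] for $(x_j)$ near $0$. *)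

theory Defs
  imports "HOL-Analysis.Analysis"
begin

text \<open>
  The indices \<open>1, ..., r\<close> are the elements of an arbitrary finite linearly ordered (nonempty) type
  \<open>'r\<close>, so that \<open>r = CARD('r) \<ge> 1\<close> and \<open>complex^'r\<close> is the space of \<open>r\<close>-tuples.
\<close>

definition tail_sum :: "('a::comm_monoid_add)^'r::{finite,linorder} \<Rightarrow> 'r \<Rightarrow> 'a" where
  "tail_sum x j = (\<Sum>\<nu>\<in>{j..}. x $ \<nu>)"

definition Li_shuffle :: "complex^'r::{finite,linorder} \<Rightarrow> complex^'r::{finite,linorder} \<Rightarrow> complex" where
  "Li_shuffle s z =
     (\<Sum>\<^sub>\<infinity>l\<in>{l :: 'r \<Rightarrow> nat. \<forall>j. 1 \<le> l j}.
        (\<Prod>j\<in>UNIV. z $ j ^ l j) / (\<Prod>j\<in>UNIV. of_nat (\<Sum>\<nu>\<in>{..j}. l \<nu>) powr (s $ j)))"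

definition neg_tuple :: "('r::{finite,linorder} \<Rightarrow> nat) \<Rightarrow> complex^'r::{finite,linorder}" where
  "neg_tuple k = (\<chi> j. - of_nat (k j))"

definition polynomial_fun :: "(complex^'r::{finite,linorder} \<Rightarrow> complex) \<Rightarrow> bool" where
  "polynomial_fun P \<longleftrightarrow>
     (\<exists>(E :: ('r \<Rightarrow> nat) set) c. finite E \<and> P = (\<lambda>z. \<Sum>e\<in>E. c e * (\<Prod>j\<in>UNIV. z $ j ^ e j)))"

text \<open>
  The series \<open>Li_shuffle (neg_tuple k)\<close> converges only on the open unit polydisc; the following is
  the rational function it defines. The numerator is determined by its values on the polydisc, so the
  description is unique. (Where the denominator vanishes the value is the conventional \<open>0\<close>.)
\<close>

definition Li_shuffle_rat :: "('r::{finite,linorder} \<Rightarrow> nat) \<Rightarrow> complex^'r::{finite,linorder} \<Rightarrow> complex" where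
  "Li_shuffle_rat k =
     (THE R. (\<exists>P. polynomial_fun P \<and>
                (\<forall>z. R z = P z / (\<Prod>j\<in>UNIV. (1 - z $ j) ^ ((\<Sum>\<nu>\<in>{j..}. k \<nu>) + 1)))) \<and>
             (\<forall>z. (\<forall>j. norm (z $ j) < 1) \<longrightarrow> R z = Li_shuffle (neg_tuple k) z))"

text \<open>
  The generating function has removable singularities along the hyperplanes \<open>X\<^sub>j = 0\<close>, where the
  quotient below would be \<open>0 / 0\<close>; the expansion is required at all other points near the origin,
  which still determines the coefficients.
\<close>

definition multi_poly_Bernoulli :: "complex^'r::{finite,linorder} \<Rightarrow> ('r \<Rightarrow> nat) \<Rightarrow> complex" where
  "multi_poly_Bernoulli s =
     (THE B. \<forall>\<^sub>F x in nhds (0 :: complex^'r::{finite,linorder}). (\<forall>j. tail_sum x j \<noteq> 0) \<longrightarrow>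
        ((\<lambda>m. B m * (\<Prod>j\<in>UNIV. x $ j ^ m j / fact (m j))) has_sum
           Li_shuffle s (\<chi> j. 1 - exp (- tail_sum x j)) / (\<Prod>j\<in>UNIV. 1 - exp (- tail_sum x j)))
          UNIV)"

definition eta_integrand ::
    "('r::{finite,linorder} \<Rightarrow> nat) \<Rightarrow> complex^'r::{finite,linorder} \<Rightarrow> real^'r::{finite,linorder} \<Rightarrow> complex" where
  "eta_integrand k s t =
     (\<Prod>j\<in>UNIV. of_real (t $ j) powr (s $ j - 1)) *
     (Li_shuffle_rat k (\<chi> j. 1 - of_real (exp (tail_sum t j))) /
       (\<Prod>j\<in>UNIV. 1 - of_real (exp (tail_sum t j))))"

definition eta :: "('r::{finite,linorder} \<Rightarrow> nat) \<Rightarrow> complex^'r::{finite,linorder} \<Rightarrow> complex" where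
  "eta k s =
     1 / (\<Prod>j\<in>UNIV. Gamma (s $ j)) *
     (LINT t:{t. \<forall>j. 0 < t $ j}|lborel. eta_integrand k s t)"

text \<open>
  Holomorphy in several variables: Frechet differentiability with complex-linear derivative.
\<close>

definition entire_fun :: "(complex^'r::{finite,linorder} \<Rightarrow> complex) \<Rightarrow> bool" where
  "entire_fun F \<longleftrightarrow>
     (\<forall>s. \<exists>D. (F has_derivative D) (at s) \<and> (\<forall>c v. D (c *s v) = c * D v))"

end

theory Submission
  imports Defs
begin

text \<open>
  With \<open>l\<^sub>j = n\<^sub>j + 1\<close>, the factor \<open>\<Prod>\<^sub>j (l\<^sub>1 + \<dots> + l\<^sub>j)\<^bsup>k\<^sub>j\<^esup>\<close> of the series at negative indices is a
  combination, with coefficients \<open>c\<^sub>b\<close>, of the products \<open>\<Prod>\<^sub>j C(n\<^sub>j + b\<^sub>j, b\<^sub>j)\<close>, where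
  \<open>b\<^sub>j \<le> k\<^sub>j + \<dots> + k\<^sub>r\<close>. Summing gives \<open>Li(z) / \<Prod>\<^sub>j z\<^sub>j = \<Sum>\<^sub>b c\<^sub>b \<Prod>\<^sub>j (1 / (1 - z\<^sub>j))\<^bsup>b\<^sub>j + 1\<^esup>\<close>.
  For \<open>z\<^sub>j = 1 - exp T\<^sub>j\<close> this is \<open>\<Sum>\<^sub>b c\<^sub>b exp (- \<Sum>\<^sub>j e\<^sub>j t\<^sub>j)\<close> with the integers
  \<open>e\<^sub>j = (b\<^sub>1 + 1) + \<dots> + (b\<^sub>j + 1) \<ge> 1\<close>, so the integral factors into Gamma integrals and \<open>\<eta>\<close> equals
  \<open>\<Sum>\<^sub>b c\<^sub>b \<Prod>\<^sub>j e\<^sub>j\<^bsup>-s\<^sub>j\<^esup>\<close>, an entire function. For \<open>z\<^sub>j = 1 - exp (- X\<^sub>j)\<close> it is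
  \<open>\<Sum>\<^sub>b c\<^sub>b exp (\<Sum>\<^sub>j e\<^sub>j x\<^sub>j)\<close>, whose Taylor coefficients are the values of that function at \<open>s = -m\<close>.
\<close>

section \<open>Multi-indexed series and uniqueness of coefficients\<close>

lemma finite_atMost_fun [simp]: "finite {..d :: 'i::finite \<Rightarrow> nat}"
proof -
  have "{..d} = (\<Pi>\<^sub>E i\<in>UNIV. {..d i})"
    by (auto simp: le_fun_def PiE_iff)
  then show ?thesis
    by (simp add: finite_PiE)
qed

text \<open>Repeated multiplication of absolutely convergent series. It is the passage from one
  variable to several, both for the binomial series behind \<open>Li_shuffle\<close> and for the
  exponential series.\<close>

lemma has_sum_prod_UNIV:
  fixes f :: "'i::finite \<Rightarrow> nat \<Rightarrow> complex"
  assumes "\<And>i. summable (\<lambda>n. norm (f i n))"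
  shows "((\<lambda>n. \<Prod>i\<in>UNIV. f i (n i)) has_sum (\<Prod>i\<in>UNIV. \<Sum>n. f i n)) UNIV"
proof -
  have abs: "(\<lambda>n. norm (f i n)) summable_on UNIV" for i
    using assms by (simp add: summable_on_UNIV_nonneg_real_iff)
  \<comment> \<open>The product theorems for infinite sums range over extensional functions, which
    over \<open>UNIV\<close> are all functions.\<close>
  have eq: "(\<Pi>\<^sub>E i\<in>(UNIV :: 'i set). (UNIV :: nat set)) = UNIV"
    by auto
  have "Infinite_Set_Sum.abs_summable_on (\<lambda>n. \<Prod>i\<in>UNIV. f i (n i)) (\<Pi>\<^sub>E i\<in>UNIV. UNIV)"
    using abs by (intro abs_summable_on_prod_PiE) (auto simp: abs_summable_equivalent)
  then have "(\<lambda>n. \<Prod>i\<in>UNIV. f i (n i)) summable_on UNIV"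
    unfolding eq abs_summable_equivalent[symmetric] by (rule abs_summable_summable)
  moreover have "infsum (\<lambda>n. \<Prod>i\<in>UNIV. f i (n i)) (\<Pi>\<^sub>E i\<in>UNIV. UNIV) = (\<Prod>i\<in>UNIV. infsum (f i) UNIV)"
    using abs by (intro infsum_prod_PiE_abs) auto
  moreover have "infsum (f i) UNIV = (\<Sum>n. f i n)" for i
    using assms[of i] norm_summable_imp_has_sum[OF assms[of i]] summable_norm_cancel[OF assms[of i]]
    by (simp add: infsumI summable_sums)
  ultimately show ?thesis
    unfolding eq by (simp add: has_sum_iff)
qed

lemma has_sum_finite_sum:
  fixes f :: "'a \<Rightarrow> 'b \<Rightarrow> 'c::topological_comm_monoid_add"
  assumes "\<And>a. a \<in> A \<Longrightarrow> (f a has_sum s a) B"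
  shows "((\<lambda>x. \<Sum>a\<in>A. f a x) has_sum (\<Sum>a\<in>A. s a)) B"
  using assms by (induction A rule: infinite_finite_induct) (simp_all add: has_sum_add)

text \<open>Once the lower coefficients vanish, division by \<open>t ^ n\<close> leaves a power
  series whose limit at 0 is \<open>a n\<close>. Positive real arguments suffice for this, and they
  keep later evaluations away from the hyperplanes where a tail sum vanishes.\<close>

lemma power_series_zero_right:
  fixes a :: "nat \<Rightarrow> complex"
  assumes "\<delta> > 0" and zero: "\<And>t :: real. 0 < t \<Longrightarrow> t < \<delta> \<Longrightarrow> (\<lambda>n. a n * of_real t ^ n) sums 0"
  shows "a n = 0"
proof (induction n rule: less_induct)
  case (less n)
  have shifted: "(\<lambda>i. a (i + n) * of_real t ^ i) sums 0" if t: "0 < t" "t < \<delta>" for t :: real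
  proof -
    have "(\<lambda>i. a (i + n) * of_real t ^ (i + n)) sums 0"
      using zero[OF t] less by (subst sums_iff_shift) auto
    then have "(\<lambda>i. a (i + n) * of_real t ^ (i + n) / of_real t ^ n) sums (0 / of_real t ^ n)"
      by (rule sums_divide)
    then show ?thesis
      using t by (simp add: power_add)
  qed
  define f where "f = (\<lambda>x :: complex. \<Sum>i. a (i + n) * x ^ i)"
  \<comment> \<open>Convergence at the single point \<open>\<delta> / 2\<close> gives convergence on
    the complex disc of that radius, hence the limit of \<open>f\<close> at 0.\<close>
  have "summable (\<lambda>i. a (i + n) * of_real (\<delta> / 2) ^ i)"
    using sums_summable[OF shifted[of "\<delta> / 2"]] \<open>\<delta> > 0\<close> by simp
  then have "(\<lambda>i. a (i + n) * x ^ i) sums f x" if "norm x < \<delta> / 2" for x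
    unfolding f_def using that \<open>\<delta> > 0\<close>
    by (intro summable_sums) (erule powser_inside, simp add: norm_divide)
  then have "(f \<longlongrightarrow> a (0 + n)) (at 0)"
    using \<open>\<delta> > 0\<close> by (intro powser_limit_0[of "\<delta> / 2"]) auto
  moreover have "filterlim complex_of_real (at 0) (at_right 0)"
    by (rule filterlim_atI) (auto intro!: tendsto_eq_intros simp: eventually_at_filter)
  ultimately have "((\<lambda>t. f (of_real t)) \<longlongrightarrow> a n) (at_right 0)"
    using filterlim_compose by force
  moreover have "\<forall>\<^sub>F t in at_right 0. f (of_real t) = 0"
    using eventually_at_right_real[OF \<open>\<delta> > 0\<close>]
    by eventually_elim (use shifted in \<open>auto simp: f_def sums_iff\<close>)
  ultimately have "((\<lambda>_. 0) \<longlongrightarrow> a n) (at_right (0 :: real))"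
    using tendsto_cong by force
  then show ?case
    by (simp add: tendsto_const_iff)
qed

text \<open>Induction on the set of variables. Splitting off the variable \<open>j\<close> turns the
  sum into a power series in that variable alone; its coefficients vanish by the one-variable case,
  and each is again a series of the same kind over \<open>A\<close>. Restricting the multi-indices
  to those supported in \<open>A\<close> keeps the index type fixed.\<close>

lemma multi_power_series_zero:
  fixes a :: "('i \<Rightarrow> nat) \<Rightarrow> complex"
  assumes "finite A" "\<delta> > 0"
    and "\<And>x :: 'i \<Rightarrow> real. (\<And>i. 0 < x i \<and> x i < \<delta>) \<Longrightarrow>
           ((\<lambda>m. a m * (\<Prod>i\<in>A. of_real (x i) ^ m i)) has_sum 0) {m. \<forall>i. i \<notin> A \<longrightarrow> m i = 0}"
    and "\<forall>i. i \<notin> A \<longrightarrow> m i = 0"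
  shows "a m = 0"
  using assms(1,3,4)
proof (induction A arbitrary: a m rule: finite_induct)
  case empty
  have "{m :: 'i \<Rightarrow> nat. \<forall>i. i \<notin> {} \<longrightarrow> m i = 0} = {\<lambda>_. 0}"
    by auto
  then show ?case
    using empty.prems(1)[of "\<lambda>_. \<delta> / 2"] empty.prems(2) \<open>\<delta> > 0\<close> by (auto simp: has_sum_iff fun_eq_iff)
next
  case (insert j A)
  let ?S = "{m :: 'i \<Rightarrow> nat. \<forall>i. i \<notin> A \<longrightarrow> m i = 0}"
  let ?T = "{m :: 'i \<Rightarrow> nat. \<forall>i. i \<notin> insert j A \<longrightarrow> m i = 0}"
  \<comment> \<open>Inserting the exponent \<open>n\<close> at \<open>j\<close> is a bijection from
    \<open>UNIV \<times> ?S\<close> onto \<open>?T\<close>, because members of \<open>?S\<close> are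
    0 at \<open>j\<close>.\<close>
  let ?h = "\<lambda>(n, m :: 'i \<Rightarrow> nat). m(j := n :: nat)"
  have inj: "inj_on ?h (UNIV \<times> ?S)"
    using insert.hyps(2) by (auto simp: inj_on_def fun_eq_iff split: if_splits)
  have img: "?h ` (UNIV \<times> ?S) = ?T"
  proof (intro equalityI subsetI)
    fix m assume "m \<in> ?T"
    then show "m \<in> ?h ` (UNIV \<times> ?S)"
      using insert.hyps(2) by (intro image_eqI[of _ _ "(m j, m(j := 0))"]) auto
  qed (use insert.hyps(2) in auto)
  have coeff: "a (m(j := n)) = 0" if "m \<in> ?S" for n m
  proof (rule insert.IH[of "\<lambda>m. a (m(j := n))"])
    fix x :: "'i \<Rightarrow> real"
    assume x: "\<And>i. 0 < x i \<and> x i < \<delta>"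
    define g where "g = (\<lambda>n m. a (m(j := n)) * (\<Prod>i\<in>A. of_real (x i) ^ m i) :: complex)"
    have pair: "((\<lambda>(n, m). of_real t ^ n * g n m) has_sum 0) (UNIV \<times> ?S)" if t: "0 < t" "t < \<delta>" for t
    proof -
      define y where "y = x(j := t)"
      have "0 < y i \<and> y i < \<delta>" for i
        using x t by (auto simp: y_def)
      from insert.prems(1)[OF this] have sum:
        "((\<lambda>m. a m * (\<Prod>i\<in>insert j A. of_real (y i) ^ m i)) \<circ> ?h has_sum 0) (UNIV \<times> ?S)"
        unfolding img[symmetric] has_sum_reindex[OF inj] .
      have "a (m(j := n)) * (\<Prod>i\<in>insert j A. of_real (y i) ^ (m(j := n)) i) = of_real t ^ n * g n m" for n m
      proof -
        have "(\<Prod>i\<in>A. of_real (y i) ^ (m(j := n)) i) = (\<Prod>i\<in>A. of_real (x i) ^ m i :: complex)"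
          using insert.hyps by (intro prod.cong) (auto simp: y_def)
        then show ?thesis
          using insert.hyps by (simp add: y_def g_def)
      qed
      then have "(\<lambda>m. a m * (\<Prod>i\<in>insert j A. of_real (y i) ^ m i)) \<circ> ?h = (\<lambda>(n, m). of_real t ^ n * g n m)"
        by (auto simp: fun_eq_iff)
      with sum show ?thesis
        by (simp only:)
    qed
    \<comment> \<open>A row of a summable family is summable; at \<open>t = \<delta>/2\<close> the
      extra factor \<open>t ^ n\<close> is nonzero and can be removed.\<close>
    have "(\<lambda>m. g n m) summable_on ?S" for n
    proof -
      have "(\<lambda>m. of_real (\<delta>/2) ^ n * g n m) summable_on ?S"
        using has_sum_imp_summable[OF pair[of "\<delta>/2"]] \<open>\<delta> > 0\<close>
        by (intro summable_on_SigmaD1[of "\<lambda>n m. of_real (\<delta>/2) ^ n * g n m" UNIV "\<lambda>_. ?S" n]) auto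
      then show ?thesis
        using \<open>\<delta> > 0\<close> summable_on_cmult_right'[of "of_real (\<delta>/2) ^ n :: complex" "g n" ?S] by simp
    qed
    then have row: "(g n has_sum infsum (g n) ?S) ?S" for n
      by simp
    \<comment> \<open>Summing over \<open>m\<close> first, the double sum is a power series in
      \<open>t\<close> that is 0 on the whole interval from 0 to \<open>\<delta>\<close>.\<close>
    have "infsum (g n) ?S = 0" for n
    proof (rule power_series_zero_right[OF \<open>\<delta> > 0\<close>, of "\<lambda>n. infsum (g n) ?S"])
      fix t :: real assume "0 < t" "t < \<delta>"
      from pair[OF this] have "((\<lambda>n. of_real t ^ n * infsum (g n) ?S) has_sum 0) UNIV"
        by (rule has_sum_SigmaD) (use has_sum_cmult_right[OF row] in auto)
      then show "(\<lambda>n. infsum (g n) ?S * of_real t ^ n) sums 0"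
        by (simp add: has_sum_imp_sums mult.commute)
    qed
    with row show "((\<lambda>m. a (m(j := n)) * (\<Prod>i\<in>A. of_real (x i) ^ m i)) has_sum 0) ?S"
      by (simp add: g_def)
  qed (use that in auto)
  have "a ((m(j := 0))(j := m j)) = 0"
    using insert.prems(2) by (intro coeff) auto
  then show ?case
    by simp
qed

section \<open>The binomial basis\<close>

text \<open>
  Here \<open>n i = l\<^sub>i - 1\<close>. The polynomials \<open>C(n + b, b)\<close> are preferred to the powers of \<open>l\<close> because
  \<open>\<Sum>\<^sub>n C(n + b, b) z\<^bsup>n\<^esup> = (1 / (1 - z))\<^bsup>b + 1\<^esup>\<close>.
\<close>

definition binom_prod :: "('i::finite \<Rightarrow> nat) \<Rightarrow> ('i \<Rightarrow> nat) \<Rightarrow> complex" where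
  "binom_prod b n = (\<Prod>i\<in>UNIV. of_nat (n i + b i choose b i))"

text \<open>The order on \<open>d\<close> is pointwise, so \<open>{..d}\<close> is a finite box. The
  bound is tracked separately in each variable because it later has to fit the exponent of
  \<open>1 - z $ j\<close> in the prescribed denominator.\<close>

definition binom_span :: "('i::finite \<Rightarrow> nat) \<Rightarrow> (('i \<Rightarrow> nat) \<Rightarrow> complex) set" where
  "binom_span d = {f. \<exists>c. \<forall>n. f n = (\<Sum>b\<in>{..d}. c b * binom_prod b n)}"

lemma binom_spanE:
  assumes "f \<in> binom_span d"
  obtains c where "\<And>n. f n = (\<Sum>b\<in>{..d}. c b * binom_prod b n)"
  using assms by (auto simp: binom_span_def)

lemma binom_spanI:
  assumes "\<And>n. f n = (\<Sum>b\<in>{..d}. c b * binom_prod b n)"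
  shows "f \<in> binom_span d"
  using assms by (auto simp: binom_span_def)

lemma binom_span_mono:
  assumes "f \<in> binom_span d" "d \<le> d'"
  shows "f \<in> binom_span d'"
proof -
  from assms(1) obtain c where c: "\<And>n. f n = (\<Sum>b\<in>{..d}. c b * binom_prod b n)"
    by (rule binom_spanE) blast
  have "f n = (\<Sum>b\<in>{..d'}. (if b \<le> d then c b else 0) * binom_prod b n)" for n
    unfolding c using assms(2) by (intro sum.mono_neutral_cong_left) auto
  then show ?thesis
    by (rule binom_spanI)
qed

lemma binom_span_add:
  assumes "f \<in> binom_span d" "g \<in> binom_span d"
  shows "(\<lambda>n. f n + g n) \<in> binom_span d"
proof -
  from assms(1) obtain c where c: "\<And>n. f n = (\<Sum>b\<in>{..d}. c b * binom_prod b n)"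
    by (rule binom_spanE) blast
  from assms(2) obtain c' where c': "\<And>n. g n = (\<Sum>b\<in>{..d}. c' b * binom_prod b n)"
    by (rule binom_spanE) blast
  have "f n + g n = (\<Sum>b\<in>{..d}. (c b + c' b) * binom_prod b n)" for n
    unfolding c c' by (simp add: sum.distrib distrib_right)
  then show ?thesis
    by (rule binom_spanI)
qed

lemma binom_span_cmult:
  assumes "f \<in> binom_span d"
  shows "(\<lambda>n. a * f n) \<in> binom_span d"
proof -
  from assms(1) obtain c where c: "\<And>n. f n = (\<Sum>b\<in>{..d}. c b * binom_prod b n)"
    by (rule binom_spanE) blast
  show ?thesis
    by (rule binom_spanI[where c = "\<lambda>b. a * c b"]) (simp add: c sum_distrib_left mult.assoc)
qed

lemma binom_span_sum:
  assumes "\<And>x. x \<in> A \<Longrightarrow> f x \<in> binom_span d"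
  shows "(\<lambda>n. \<Sum>x\<in>A. f x n) \<in> binom_span d"
  using assms
proof (induction A rule: infinite_finite_induct)
  case (insert x A)
  then show ?case
    by (simp add: binom_span_add)
qed (auto simp: binom_span_def intro!: exI[of _ "\<lambda>_. 0"])

lemma binom_prod_in_span: "b \<le> d \<Longrightarrow> binom_prod b \<in> binom_span d"
  by (rule binom_spanI[where c = "\<lambda>b'. if b' = b then 1 else 0"]) (simp add: if_distrib[of "\<lambda>x. x * _"] cong: if_cong)

text \<open>In one variable this is
  \<open>(b + 1) C(n + b + 1, b + 1) = (n + b + 1) C(n + b, b)\<close>, solved for
  \<open>(n + 1) C(n + b, b)\<close>; the factors at other indices are unchanged. Hence
  multiplication by \<open>Suc (n i)\<close> raises the bound at \<open>i\<close> by one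
  only.\<close>

lemma Suc_mult_binom_prod:
  "of_nat (Suc (n i)) * binom_prod b n =
     of_nat (Suc (b i)) * binom_prod (b(i := Suc (b i))) n - of_nat (b i) * binom_prod b n"
proof -
  have split: "binom_prod b' n = of_nat (n i + b' i choose b' i) *
      (\<Prod>j\<in>UNIV - {i}. of_nat (n j + b' j choose b' j))" for b'
    unfolding binom_prod_def by (rule prod.remove) auto
  have "(n i + Suc (b i) choose Suc (b i)) * Suc (b i) = Suc (n i + b i) * (n i + b i choose b i)"
    using Suc_times_binomial_eq[of "n i + b i" "b i"] by simp
  then have "(of_nat ((n i + Suc (b i) choose Suc (b i)) * Suc (b i)) :: complex) =
      of_nat (Suc (n i + b i) * (n i + b i choose b i))"
    by (simp only:)
  then have eq: "of_nat (Suc (b i)) * of_nat (n i + Suc (b i) choose Suc (b i)) =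
      (of_nat (Suc (n i)) + of_nat (b i)) * (of_nat (n i + b i choose b i) :: complex)"
    unfolding of_nat_mult by (simp add: algebra_simps)
  have rest: "(\<Prod>j\<in>UNIV - {i}. of_nat (n j + (b(i := Suc (b i))) j choose (b(i := Suc (b i))) j)) =
      (\<Prod>j\<in>UNIV - {i}. of_nat (n j + b j choose b j) :: complex)"
    by (intro prod.cong) auto
  have "of_nat (Suc (b i)) * binom_prod (b(i := Suc (b i))) n =
      (of_nat (Suc (n i)) + of_nat (b i)) * binom_prod b n"
    unfolding split[of b] split[of "b(i := Suc (b i))"] rest mult.assoc[symmetric]
    using eq by simp
  then show ?thesis
    by (simp add: algebra_simps)
qed

lemma binom_span_mult_Suc:
  assumes "f \<in> binom_span d"
  shows "(\<lambda>n. of_nat (Suc (n i)) * f n) \<in> binom_span (d(i := Suc (d i)))"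
proof -
  from assms(1) obtain c where c: "\<And>n. f n = (\<Sum>b\<in>{..d}. c b * binom_prod b n)"
    by (rule binom_spanE) blast
  have eq: "of_nat (Suc (n i)) * f n =
      (\<Sum>b\<in>{..d}. c b * of_nat (Suc (b i)) * binom_prod (b(i := Suc (b i))) n +
         (- c b * of_nat (b i)) * binom_prod b n)" for n
  proof -
    have "of_nat (Suc (n i)) * f n = (\<Sum>b\<in>{..d}. c b * (of_nat (Suc (n i)) * binom_prod b n))"
      unfolding c sum_distrib_left by (simp only: mult.left_commute)
    then show ?thesis
      unfolding Suc_mult_binom_prod by (simp add: algebra_simps)
  qed
  show ?thesis
    unfolding eq
    by (intro binom_span_sum binom_span_add binom_span_cmult binom_prod_in_span)
       (auto simp: le_fun_def le_SucI)
qed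

lemma binom_span_mult_sum_Suc:
  assumes "f \<in> binom_span d"
  shows "(\<lambda>n. of_nat (\<Sum>i\<in>A. Suc (n i)) * f n) \<in> binom_span (\<lambda>i. d i + (if i \<in> A then 1 else 0))"
proof -
  have "(\<lambda>n. of_nat (Suc (n i)) * f n) \<in> binom_span (\<lambda>i. d i + (if i \<in> A then 1 else 0))" if "i \<in> A" for i
    using binom_span_mult_Suc[OF assms] by (rule binom_span_mono) (use that in \<open>auto simp: le_fun_def\<close>)
  then have "(\<lambda>n. \<Sum>i\<in>A. of_nat (Suc (n i)) * f n) \<in> binom_span (\<lambda>i. d i + (if i \<in> A then 1 else 0))"
    by (rule binom_span_sum)
  then show ?thesis
    by (simp add: sum_distrib_right)
qed

lemma binom_span_mult_sum_Suc_power: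
  assumes "f \<in> binom_span d"
  shows "(\<lambda>n. of_nat (\<Sum>i\<in>A. Suc (n i)) ^ p * f n) \<in> binom_span (\<lambda>i. d i + (if i \<in> A then p else 0))"
proof (induction p)
  case (Suc p)
  have "(\<lambda>i. d i + (if i \<in> A then p else 0) + (if i \<in> A then 1 else 0)) =
      (\<lambda>i. d i + (if i \<in> A then Suc p else 0))"
    by auto
  with binom_span_mult_sum_Suc[OF Suc, of A] show ?case
    by (simp only: power_Suc mult.assoc)
qed (use assms in simp)

text \<open>The factor for \<open>j\<close> involves the variables \<open>i \<le> j\<close> and
  raises the bound of each by \<open>k j\<close>. So the variable \<open>i\<close> collects
  \<open>k j\<close> for all \<open>j \<ge> i\<close>, which is the exponent in the denominator less
  one.\<close>

lemma prod_partial_sums_in_span: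
  fixes k :: "'r::{finite,linorder} \<Rightarrow> nat"
  shows "(\<lambda>n. \<Prod>j\<in>UNIV. of_nat (\<Sum>\<nu>\<in>{..j}. Suc (n \<nu>)) ^ k j) \<in> binom_span (\<lambda>i. \<Sum>\<nu>\<in>{i..}. k \<nu>)"
proof -
  have span: "(\<lambda>n. \<Prod>j\<in>J. of_nat (\<Sum>\<nu>\<in>{..j}. Suc (n \<nu>)) ^ k j)
      \<in> binom_span (\<lambda>i. \<Sum>j\<in>J. if i \<in> {..j} then k j else 0)" if "finite J" for J
    using that
  proof induction
    case empty
    have "binom_prod (\<lambda>_. 0) \<in> binom_span (\<lambda>_ :: 'r. 0)"
      by (rule binom_prod_in_span) simp
    then show ?case
      by (simp add: binom_prod_def[abs_def])
  next
    case (insert j J)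
    show ?case
      using binom_span_mult_sum_Suc_power[OF insert.IH, of "{..j}" "k j"] insert.hyps
      by (simp add: add.commute)
  qed
  have "(\<Sum>j\<in>UNIV. if i \<in> {..j} then k j else 0) = (\<Sum>\<nu>\<in>{i..}. k \<nu>)" for i
    by (simp add: sum.If_cases atLeast_def)
  with span[of UNIV] show ?thesis
    by (simp only: finite)
qed

section \<open>The rational function\<close>

text \<open>Newton's binomial series with exponent \<open>-(b + 1)\<close>; negating the upper index
  makes the generalized coefficients ordinary ones.\<close>

lemma binomial_power_series:
  fixes z :: complex
  assumes "norm z < 1"
  shows "(\<lambda>n. of_nat (n + b choose b) * z ^ n) sums (1 / (1 - z)) ^ Suc b"
proof -
  have "(\<lambda>n. (- of_nat (Suc b) gchoose n) * (- z) ^ n) sums (1 + - z) powr (- of_nat (Suc b))"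
    using assms by (intro gen_binomial_complex) simp
  moreover have "(- of_nat (Suc b) gchoose n) * (- z) ^ n = of_nat (n + b choose b) * z ^ n" for n
  proof -
    have "(of_nat (Suc b) + of_nat n - 1 :: complex) = of_nat (n + b)"
      by simp
    then have "(- of_nat (Suc b) gchoose n :: complex) = (- 1) ^ n * of_nat (n + b choose n)"
      unfolding gbinomial_minus binomial_gbinomial by (simp only:)
    moreover have "(n + b choose n) = (n + b choose b)"
      using binomial_symmetric[of n "n + b"] by simp
    ultimately show ?thesis
      by (simp add: power_minus[of z])
  qed
  moreover have "(1 + - z) powr (- of_nat (Suc b)) = (1 / (1 - z)) ^ Suc b"
    using assms by (auto simp: powr_minus powr_nat' field_simps simp del: of_nat_Suc)
  ultimately show ?thesis
    by simp
qed

text \<open>The coefficients are nonnegative, so the series of norms is the same series at the point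
  \<open>norm z\<close>.\<close>

lemma summable_norm_binomial_power_series:
  fixes z :: complex
  assumes "norm z < 1"
  shows "summable (\<lambda>n. norm (of_nat (n + b choose b) * z ^ n))"
proof -
  have "summable (\<lambda>n. of_nat (n + b choose b) * complex_of_real (norm z) ^ n)"
    using binomial_power_series[of "of_real (norm z)" b] assms by (auto simp: sums_iff)
  then have "summable (\<lambda>n. complex_of_real (norm (of_nat (n + b choose b) * z ^ n)))"
    by (simp add: norm_mult norm_power)
  then show ?thesis
    by (simp only: summable_of_real_iff)
qed

text \<open>After the shift \<open>l = n + 1\<close> each basis term is a product of one-variable
  binomial series. The factor \<open>z $ j\<close> produced by the shift is what later cancels
  against the denominators of both generating functions.\<close>

lemma Li_shuffle_neg_tuple:
  fixes k :: "'r::{finite,linorder} \<Rightarrow> nat"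
  assumes c: "\<And>n. (\<Prod>j\<in>UNIV. of_nat (\<Sum>\<nu>\<in>{..j}. Suc (n \<nu>)) ^ k j) = (\<Sum>b\<in>B. c b * binom_prod b n)"
    and z: "\<And>j. norm (z $ j) < 1"
  shows "Li_shuffle (neg_tuple k) z =
    (\<Prod>j\<in>UNIV. z $ j) * (\<Sum>b\<in>B. c b * (\<Prod>j\<in>UNIV. (1 / (1 - z $ j)) ^ Suc (b j)))"
proof -
  let ?h = "\<lambda>(n :: 'r \<Rightarrow> nat) j. Suc (n j)"
  have "l \<in> range ?h" if "\<forall>j. 1 \<le> l j" for l
    using that by (intro image_eqI[of _ _ "\<lambda>j. l j - 1"]) (auto simp: fun_eq_iff Suc_le_eq)
  then have img: "{l :: 'r \<Rightarrow> nat. \<forall>j. 1 \<le> l j} = range ?h"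
    by auto
  have inj: "inj ?h"
    by (auto simp: inj_def fun_eq_iff)
  have sum: "((\<lambda>n. (\<Prod>j\<in>UNIV. z $ j) *
            (\<Sum>b\<in>B. c b * (\<Prod>j\<in>UNIV. of_nat (n j + b j choose b j) * z $ j ^ n j))) has_sum
      (\<Prod>j\<in>UNIV. z $ j) * (\<Sum>b\<in>B. c b * (\<Prod>j\<in>UNIV. \<Sum>n. of_nat (n + b j choose b j) * z $ j ^ n))) UNIV"
    by (intro has_sum_cmult_right has_sum_finite_sum has_sum_prod_UNIV summable_norm_binomial_power_series z)
  have val: "(\<Sum>n. of_nat (n + b j choose b j) * z $ j ^ n) = (1 / (1 - z $ j)) ^ Suc (b j)" for b j
    using binomial_power_series[OF z] by (rule sums_unique[symmetric])
  have summand: "(\<Prod>j\<in>UNIV. z $ j ^ ?h n j) /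
        (\<Prod>j\<in>UNIV. of_nat (\<Sum>\<nu>\<in>{..j}. ?h n \<nu>) powr (neg_tuple k $ j)) =
      (\<Prod>j\<in>UNIV. z $ j) * (\<Sum>b\<in>B. c b * (\<Prod>j\<in>UNIV. of_nat (n j + b j choose b j) * z $ j ^ n j))" for n
  proof -
    \<comment> \<open>A nonzero base is essential when \<open>k j = 0\<close>, since
      \<open>0 powr 0\<close> is 0 whereas \<open>0 ^ 0\<close> is 1.\<close>
    have "(\<Sum>\<nu>\<in>{..j}. ?h n \<nu>) > 0" for j
      by (intro sum_pos) auto
    then have "(of_nat (\<Sum>\<nu>\<in>{..j}. ?h n \<nu>) :: complex) powr (neg_tuple k $ j) =
        inverse (of_nat (\<Sum>\<nu>\<in>{..j}. ?h n \<nu>) ^ k j)" for j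
      unfolding neg_tuple_def vec_lambda_beta powr_minus
      by (subst powr_nat') (simp_all only: of_nat_eq_0_iff less_not_refl2 simp_thms)
    then have "(\<Prod>j\<in>UNIV. z $ j ^ ?h n j) /
        (\<Prod>j\<in>UNIV. of_nat (\<Sum>\<nu>\<in>{..j}. ?h n \<nu>) powr (neg_tuple k $ j)) =
        (\<Prod>j\<in>UNIV. z $ j) * (\<Prod>j\<in>UNIV. z $ j ^ n j) * (\<Prod>j\<in>UNIV. of_nat (\<Sum>\<nu>\<in>{..j}. ?h n \<nu>) ^ k j)"
      by (simp only: prod_inversef[symmetric, unfolded o_def] divide_inverse inverse_inverse_eq power_Suc prod.distrib)
    also have "\<dots> = (\<Prod>j\<in>UNIV. z $ j) *
        (\<Sum>b\<in>B. c b * ((\<Prod>j\<in>UNIV. of_nat (n j + b j choose b j)) * (\<Prod>j\<in>UNIV. z $ j ^ n j)))"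
      unfolding c binom_prod_def mult.assoc by (simp only: sum_distrib_left mult_ac)
    also have "\<dots> = (\<Prod>j\<in>UNIV. z $ j) *
        (\<Sum>b\<in>B. c b * (\<Prod>j\<in>UNIV. of_nat (n j + b j choose b j) * z $ j ^ n j))"
      by (simp only: prod.distrib)
    finally show ?thesis .
  qed
  show ?thesis
    unfolding Li_shuffle_def img infsum_reindex[OF inj] o_def summand
    using sum unfolding val by (rule infsumI)
qed

section \<open>Polynomial functions in several variables and their identity theorem\<close>

lemma polynomial_fun_const: "polynomial_fun (\<lambda>_ :: complex^'r::{finite,linorder}. a)"
  unfolding polynomial_fun_def
  by (intro exI[of _ "{\<lambda>_. 0}"] exI[of _ "\<lambda>_. a"]) simp

lemma polynomial_fun_nth: "polynomial_fun (\<lambda>z :: complex^'r::{finite,linorder}. z $ i)"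
proof -
  have "(\<Prod>j\<in>UNIV. z $ j ^ (if j = i then 1 else 0)) = z $ i" for z :: "(complex, 'r) vec"
    by (simp add: if_distrib[of "\<lambda>n. _ ^ n"] cong: if_cong)
  then show ?thesis
    unfolding polynomial_fun_def
    by (intro exI[of _ "{\<lambda>j. if j = i then 1 else 0}"] exI[of _ "\<lambda>_. 1"]) simp
qed

text \<open>Coefficients are extended by zero, so that two polynomials can be written over a common
  finite set of exponents.\<close>

lemma polynomial_funE:
  fixes P :: "complex^'r::{finite,linorder} \<Rightarrow> complex"
  assumes "polynomial_fun P"
  obtains E c where "finite E" "\<And>e. e \<notin> E \<Longrightarrow> c e = 0"
    "\<And>E' z. finite E' \<Longrightarrow> E \<subseteq> E' \<Longrightarrow> P z = (\<Sum>e\<in>E'. c e * (\<Prod>j\<in>UNIV. z $ j ^ e j))"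
proof -
  from assms obtain E c where E: "finite E" and P: "P = (\<lambda>z. \<Sum>e\<in>E. c e * (\<Prod>j\<in>UNIV. z $ j ^ e j))"
    by (auto simp: polynomial_fun_def)
  show ?thesis
  proof (rule that[of E "\<lambda>e. if e \<in> E then c e else 0"])
    show "P z = (\<Sum>e\<in>E'. (if e \<in> E then c e else 0) * (\<Prod>j\<in>UNIV. z $ j ^ e j))"
      if "finite E'" "E \<subseteq> E'" for E' z
      unfolding P using that by (intro sum.mono_neutral_cong_left) auto
  qed (use E in auto)
qed

lemma polynomial_fun_add:
  fixes P :: "complex^'r::{finite,linorder} \<Rightarrow> complex"
  assumes "polynomial_fun P" "polynomial_fun Q"
  shows "polynomial_fun (\<lambda>z. P z + Q z)"
proof -
  from assms(1) obtain E c where E: "finite E"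
    "\<And>E' z. finite E' \<Longrightarrow> E \<subseteq> E' \<Longrightarrow> P z = (\<Sum>e\<in>E'. c e * (\<Prod>j\<in>UNIV. z $ j ^ e j))"
    by (rule polynomial_funE) blast
  from assms(2) obtain D d where D: "finite D"
    "\<And>E' z. finite E' \<Longrightarrow> D \<subseteq> E' \<Longrightarrow> Q z = (\<Sum>e\<in>E'. d e * (\<Prod>j\<in>UNIV. z $ j ^ e j))"
    by (rule polynomial_funE) blast
  show ?thesis
    unfolding polynomial_fun_def
    by (intro exI[of _ "E \<union> D"] exI[of _ "\<lambda>e. c e + d e"])
       (simp add: E(1) D(1) E(2)[of "E \<union> D"] D(2)[of "E \<union> D"] sum.distrib distrib_right)
qed

lemma polynomial_fun_sum:
  fixes P :: "'a \<Rightarrow> complex^'r::{finite,linorder} \<Rightarrow> complex"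
  assumes "\<And>x. x \<in> A \<Longrightarrow> polynomial_fun (P x)"
  shows "polynomial_fun (\<lambda>z. \<Sum>x\<in>A. P x z)"
  using assms
proof (induction A rule: infinite_finite_induct)
  case (insert x A)
  then show ?case
    using polynomial_fun_add[of "P x" "\<lambda>z. \<Sum>x\<in>A. P x z"] by simp
qed (simp_all add: polynomial_fun_const)

lemma polynomial_fun_mult:
  fixes P :: "complex^'r::{finite,linorder} \<Rightarrow> complex"
  assumes "polynomial_fun P" "polynomial_fun Q"
  shows "polynomial_fun (\<lambda>z. P z * Q z)"
proof -
  from assms obtain E c D d where
    P: "P = (\<lambda>z. \<Sum>e\<in>E. c e * (\<Prod>j\<in>UNIV. z $ j ^ e j))" and
    Q: "Q = (\<lambda>z. \<Sum>e\<in>D. d e * (\<Prod>j\<in>UNIV. z $ j ^ e j))"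
    by (auto simp: polynomial_fun_def)
  have "polynomial_fun (\<lambda>z :: (complex, 'r) vec. a * (\<Prod>j\<in>UNIV. z $ j ^ (e j + e' j)))" for a e e'
    unfolding polynomial_fun_def
    by (intro exI[of _ "{\<lambda>j. e j + e' j}"] exI[of _ "\<lambda>_. a"]) simp
  then have "polynomial_fun (\<lambda>z :: (complex, 'r) vec. \<Sum>e\<in>E. \<Sum>e'\<in>D. c e * d e' * (\<Prod>j\<in>UNIV. z $ j ^ (e j + e' j)))"
    by (intro polynomial_fun_sum)
  moreover have "P z * Q z = (\<Sum>e\<in>E. \<Sum>e'\<in>D. c e * d e' * (\<Prod>j\<in>UNIV. z $ j ^ (e j + e' j)))" for z
    unfolding P Q sum_product by (simp add: power_add prod.distrib mult_ac)
  ultimately show ?thesis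
    by simp
qed

lemma polynomial_fun_prod:
  fixes P :: "'a \<Rightarrow> complex^'r::{finite,linorder} \<Rightarrow> complex"
  assumes "\<And>x. x \<in> A \<Longrightarrow> polynomial_fun (P x)"
  shows "polynomial_fun (\<lambda>z. \<Prod>x\<in>A. P x z)"
  using assms
proof (induction A rule: infinite_finite_induct)
  case (insert x A)
  then show ?case
    using polynomial_fun_mult[of "P x" "\<lambda>z. \<Prod>x\<in>A. P x z"] by simp
qed (simp_all add: polynomial_fun_const)

lemma polynomial_fun_power:
  fixes P :: "complex^'r::{finite,linorder} \<Rightarrow> complex"
  assumes "polynomial_fun P"
  shows "polynomial_fun (\<lambda>z. P z ^ n)"
proof -
  have "polynomial_fun (\<lambda>z. \<Prod>i\<in>{..<n}. P z)"
    by (intro polynomial_fun_prod assms)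
  then show ?thesis
    by (simp only: prod_constant card_lessThan)
qed

lemma polynomial_fun_diff:
  fixes P :: "complex^'r::{finite,linorder} \<Rightarrow> complex"
  assumes "polynomial_fun P" "polynomial_fun Q"
  shows "polynomial_fun (\<lambda>z. P z - Q z)"
proof -
  have "polynomial_fun (\<lambda>z. P z + (- 1) * Q z)"
    by (intro polynomial_fun_add polynomial_fun_mult polynomial_fun_const assms)
  moreover have "(\<lambda>z. P z + (- 1) * Q z) = (\<lambda>z. P z - Q z)"
    by simp
  ultimately show ?thesis
    by (rule back_subst)
qed

text \<open>A polynomial is a multi-indexed series with finitely many nonzero coefficients, so
  uniqueness of coefficients on real points of the polydisc applies. This makes the numerator in
  \<open>Li_shuffle_rat\<close> unique.\<close>

lemma polynomial_fun_eq_0: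
  fixes P :: "complex^'r::{finite,linorder} \<Rightarrow> complex"
  assumes "polynomial_fun P" and zero: "\<And>z. (\<And>j. norm (z $ j) < 1) \<Longrightarrow> P z = 0"
  shows "P z = 0"
proof -
  from assms(1) obtain E c where E: "finite E" and c: "\<And>e. e \<notin> E \<Longrightarrow> c e = 0"
    and P: "\<And>E' z. finite E' \<Longrightarrow> E \<subseteq> E' \<Longrightarrow> P z = (\<Sum>e\<in>E'. c e * (\<Prod>j\<in>UNIV. z $ j ^ e j))"
    by (rule polynomial_funE) blast
  have "c e = 0" for e
  proof (rule multi_power_series_zero[of UNIV 1 c])
    fix x :: "'r \<Rightarrow> real"
    assume x: "\<And>i. 0 < x i \<and> x i < 1"
    have "norm ((\<chi> j. complex_of_real (x j)) $ j) < 1" for j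
      using x[of j] by simp
    then have "0 = (\<Sum>e\<in>E. c e * (\<Prod>j\<in>UNIV. of_real (x j) ^ e j))"
      using zero[of "\<chi> j. of_real (x j)"] P[of E "\<chi> j. of_real (x j)"] E by simp
    then have "((\<lambda>e. c e * (\<Prod>j\<in>UNIV. of_real (x j) ^ e j)) has_sum 0) E"
      using E by (simp add: has_sum_finite_iff)
    then show "((\<lambda>e. c e * (\<Prod>j\<in>UNIV. of_real (x j) ^ e j)) has_sum 0) {m. \<forall>i. i \<notin> UNIV \<longrightarrow> m i = 0}"
      by (rule iffD1[OF has_sum_cong_neutral, rotated 3]) (use c in auto)
  qed auto
  then show ?thesis
    using P[OF E] by simp
qed

text \<open>The sum found on the polydisc is put over the prescribed denominator, and uniqueness of
  the numerator identifies the quotient with \<open>Li_shuffle_rat k\<close>. The formula is thereby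
  available outside the polydisc, as required for \<open>1 - exp T\<close> with large
  \<open>T\<close>.\<close>

lemma Li_shuffle_rat_eq:
  fixes k :: "'r::{finite,linorder} \<Rightarrow> nat"
  defines "K \<equiv> \<lambda>i. \<Sum>\<nu>\<in>{i..}. k \<nu>"
  assumes c: "\<And>n. (\<Prod>j\<in>UNIV. of_nat (\<Sum>\<nu>\<in>{..j}. Suc (n \<nu>)) ^ k j) = (\<Sum>b\<in>{..K}. c b * binom_prod b n)"
    and z: "\<And>j. z $ j \<noteq> 1"
  shows "Li_shuffle_rat k z =
    (\<Prod>j\<in>UNIV. z $ j) * (\<Sum>b\<in>{..K}. c b * (\<Prod>j\<in>UNIV. (1 / (1 - z $ j)) ^ Suc (b j)))"
proof -
  \<comment> \<open>The subtraction \<open>K j - b j\<close> does not truncate, since only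
    \<open>b \<le> K\<close> occur in the sum.\<close>
  define P where "P = (\<lambda>z :: (complex, 'r) vec. (\<Prod>j\<in>UNIV. z $ j) *
     (\<Sum>b\<in>{..K}. c b * (\<Prod>j\<in>UNIV. (1 - z $ j) ^ (K j - b j))))"
  let ?D = "\<lambda>z :: (complex, 'r) vec. \<Prod>j\<in>UNIV. (1 - z $ j) ^ (K j + 1)"
  have poly: "polynomial_fun P"
    unfolding P_def
    by (intro polynomial_fun_mult polynomial_fun_sum polynomial_fun_prod polynomial_fun_power
        polynomial_fun_diff polynomial_fun_const polynomial_fun_nth)
  have quot: "P z / ?D z =
      (\<Prod>j\<in>UNIV. z $ j) * (\<Sum>b\<in>{..K}. c b * (\<Prod>j\<in>UNIV. (1 / (1 - z $ j)) ^ Suc (b j)))"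
    if "\<And>j. z $ j \<noteq> 1" for z
  proof -
    have "(1 - z $ j) ^ (K j - b j) / (1 - z $ j) ^ (K j + 1) = (1 / (1 - z $ j)) ^ Suc (b j)"
      if "b \<le> K" for b j
    proof -
      have "b j \<le> K j"
        using that by (simp add: le_fun_def)
      then have "(1 - z $ j) ^ (K j + 1) = (1 - z $ j) ^ (K j - b j) * (1 - z $ j) ^ Suc (b j)"
        by (simp flip: power_add power_Suc)
      then show ?thesis
        using \<open>\<And>j. z $ j \<noteq> 1\<close>[of j] by (simp add: power_one_over del: power_Suc)
    qed
    then have "(\<Prod>j\<in>UNIV. (1 - z $ j) ^ (K j - b j)) / ?D z = (\<Prod>j\<in>UNIV. (1 / (1 - z $ j)) ^ Suc (b j))"
      if "b \<le> K" for b
      unfolding prod_dividef[symmetric] using that by (intro prod.cong) blast+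
    then show ?thesis
      unfolding P_def times_divide_eq_right[symmetric] sum_divide_distrib
      by (intro arg_cong2[of _ _ _ _ "(*)"] sum.cong) simp_all
  qed
  have disc: "(\<forall>j. z $ j \<noteq> 1) \<and> ?D z \<noteq> 0" if "\<And>j. norm (z $ j) < 1" for z
  proof -
    have "z $ j \<noteq> 1" for j
      using that[of j] by auto
    then show ?thesis
      by simp
  qed
  have K: "(\<Sum>\<nu>\<in>{i..}. k \<nu>) = K i" for i
    by (simp add: K_def)
  have "Li_shuffle_rat k = (\<lambda>z. P z / ?D z)"
    unfolding Li_shuffle_rat_def K
  proof (rule the_equality, intro conjI exI[of _ P] poly allI impI refl)
    fix z :: "(complex, 'r) vec"
    assume "\<forall>j. norm (z $ j) < 1"
    then have "norm (z $ j) < 1" for j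
      by blast
    then show "P z / ?D z = Li_shuffle (neg_tuple k) z"
      using disc[of z] quot[of z] Li_shuffle_neg_tuple[OF c, of z] by presburger
  next
    fix R
    assume "(\<exists>Q. polynomial_fun Q \<and> (\<forall>z. R z = Q z / ?D z)) \<and>
      (\<forall>z. (\<forall>j. norm (z $ j) < 1) \<longrightarrow> R z = Li_shuffle (neg_tuple k) z)"
    then obtain Q where Q: "polynomial_fun Q" "\<And>z. R z = Q z / ?D z"
      and R: "\<And>z. (\<And>j. norm (z $ j) < 1) \<Longrightarrow> R z = Li_shuffle (neg_tuple k) z"
      by blast
    \<comment> \<open>On the polydisc the denominator is nonzero, so equal quotients there give
      equal numerators, hence equal polynomials everywhere.\<close>
    have "Q z - P z = 0" for z
    proof (rule polynomial_fun_eq_0[OF polynomial_fun_diff[OF Q(1) poly]])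
      fix z :: "(complex, 'r) vec"
      assume z: "\<And>j. norm (z $ j) < 1"
      have "Q z / ?D z = P z / ?D z"
        using R[OF z] Q(2)[of z] quot[of z] disc[OF z] Li_shuffle_neg_tuple[OF c z] by simp
      then show "Q z - P z = 0"
        using disc[OF z] unfolding divide_cancel_right by simp
    qed
    then show "R = (\<lambda>z. P z / ?D z)"
      using Q(2) by auto
  qed
  then show ?thesis
    using quot[OF z] by simp
qed

section \<open>The generating function\<close>

lemma tail_sum_0 [simp]: "tail_sum 0 j = 0"
  by (simp add: tail_sum_def)

lemma tail_sum_minus: "tail_sum (- x) j = - tail_sum x j"
  for x :: "('a::ab_group_add)^'r::{finite,linorder}"
  by (simp add: tail_sum_def sum_negf)

text \<open>Exchanging the summations over pairs \<open>j \<le> i\<close> separates the variables: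
  \<open>x $ i\<close> collects \<open>b j + 1\<close> for every \<open>j \<le> i\<close>. The field
  is left general because complex arguments occur in the generating function and real ones in the
  integral.\<close>

lemma prod_exp_tail_sum:
  fixes x :: "('a::{real_normed_field,banach})^'r::{finite,linorder}"
  shows "(\<Prod>j\<in>UNIV. exp (tail_sum x j) ^ Suc (b j)) =
    (\<Prod>j\<in>UNIV. exp (of_nat (\<Sum>i\<in>{..j}. Suc (b i)) * x $ j))"
proof -
  have "(\<Sum>j\<in>UNIV. of_nat (Suc (b j)) * tail_sum x j) =
      (\<Sum>j\<in>UNIV. \<Sum>i\<in>{i\<in>UNIV. j \<le> i}. of_nat (Suc (b j)) * x $ i)"
    by (simp only: tail_sum_def sum_distrib_left atLeast_def UNIV_I simp_thms)
  also have "\<dots> = (\<Sum>i\<in>UNIV. \<Sum>j\<in>{j\<in>UNIV. j \<le> i}. of_nat (Suc (b j)) * x $ i)"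
    by (rule sum.swap_restrict) auto
  also have "\<dots> = (\<Sum>j\<in>UNIV. of_nat (\<Sum>i\<in>{..j}. Suc (b i)) * x $ j)"
    by (simp only: of_nat_sum sum_distrib_right atMost_def UNIV_I simp_thms)
  finally show ?thesis
    by (simp only: exp_of_nat_mult[symmetric] exp_sum[symmetric] finite)
qed

lemma has_sum_exp_multi:
  fixes a x :: "'i::finite \<Rightarrow> complex"
  shows "((\<lambda>m. \<Prod>j\<in>UNIV. a j ^ m j * (x j ^ m j / fact (m j))) has_sum (\<Prod>j\<in>UNIV. exp (a j * x j))) UNIV"
proof -
  have eq: "a j ^ n * (x j ^ n / fact n) = (a j * x j) ^ n /\<^sub>R fact n" for j n
    by (simp add: power_mult_distrib scaleR_conv_of_real field_simps)
  show ?thesis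
    unfolding eq exp_def by (intro has_sum_prod_UNIV summable_norm_exp)
qed

lemma eventually_tail_sum:
  fixes P :: "complex \<Rightarrow> bool"
  assumes "eventually P (nhds 0)"
  shows "\<forall>\<^sub>F x in nhds (0 :: complex^'r::{finite,linorder}). \<forall>j. P (tail_sum x j)"
proof -
  have "((\<lambda>x :: complex^'r::{finite,linorder}. tail_sum x j) \<longlongrightarrow> tail_sum 0 j) (nhds 0)" for j
    unfolding tail_sum_def by (intro tendsto_sum tendsto_vec_nth filterlim_ident)
  then have "\<forall>\<^sub>F x in nhds (0 :: complex^'r::{finite,linorder}). P (tail_sum x j)" for j
    using assms by (simp add: filterlim_iff)
  then show ?thesis
    by (rule eventually_all_finite)
qed

text \<open>Near 0 the generating function is a finite combination of exponentials, and its Taylor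
  coefficients can be read off. Most of the remaining work shows that the expansion determines them
  although it is required only off the hyperplanes.\<close>

lemma multi_poly_Bernoulli_neg_tuple:
  fixes k :: "'r::{finite,linorder} \<Rightarrow> nat"
  assumes c: "\<And>n. (\<Prod>j\<in>UNIV. of_nat (\<Sum>\<nu>\<in>{..j}. Suc (n \<nu>)) ^ k j) = (\<Sum>b\<in>B. c b * binom_prod b n)"
  shows "multi_poly_Bernoulli (neg_tuple k) m =
    (\<Sum>b\<in>B. c b * (\<Prod>j\<in>UNIV. of_nat (\<Sum>i\<in>{..j}. Suc (b i)) ^ m j))"
proof -
  let ?B = "\<lambda>m. \<Sum>b\<in>B. c b * (\<Prod>j\<in>UNIV. of_nat (\<Sum>i\<in>{..j}. Suc (b i)) ^ m j)"
  define G where "G = (\<lambda>x :: (complex, 'r) vec.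
    Li_shuffle (neg_tuple k) (\<chi> j. 1 - exp (- tail_sum x j)) / (\<Prod>j\<in>UNIV. 1 - exp (- tail_sum x j)))"
  define expands where "expands = (\<lambda>C x. (\<forall>j. tail_sum x j \<noteq> 0) \<longrightarrow>
      ((\<lambda>m. C m * (\<Prod>j\<in>UNIV. x $ j ^ m j / fact (m j))) has_sum G x) UNIV)"
  have "((\<lambda>w :: complex. norm (1 - exp (- w))) \<longlongrightarrow> norm (1 - exp (- 0 :: complex))) (nhds 0)"
    by (intro tendsto_intros filterlim_ident)
  then have "\<forall>\<^sub>F w in nhds (0 :: complex). norm (1 - exp (- w)) < 1"
    by (intro order_tendstoD(2)) auto
  \<comment> \<open>The first bound places the arguments in the polydisc; this one guarantees that
    \<open>exp (- w) = 1\<close> only for \<open>w = 0\<close>, because \<open>exp\<close> is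
    injective where imaginary parts differ by less than \<open>2 * pi\<close>.\<close>
  moreover have "\<forall>\<^sub>F w in nhds (0 :: complex). norm w < 1"
    using eventually_nhds_ball[of 1 "0 :: complex"] by (simp add: dist_norm)
  ultimately have "\<forall>\<^sub>F w in nhds (0 :: complex). norm (1 - exp (- w)) < 1 \<and> norm w < 1"
    by (rule eventually_conj)
  then have ev: "\<forall>\<^sub>F x in nhds (0 :: (complex, 'r) vec). \<forall>j.
      norm (1 - exp (- tail_sum x j)) < 1 \<and> norm (tail_sum x j) < 1"
    by (rule eventually_tail_sum)
  have exists: "\<forall>\<^sub>F x in nhds 0. expands ?B x"
    using ev
  proof eventually_elim
    case (elim x)
    show ?case
      unfolding expands_def
    proof (intro impI)
      assume nz: "\<forall>j. tail_sum x j \<noteq> 0"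
      let ?z = "\<chi> j. 1 - exp (- tail_sum x j)"
      have "1 - exp (- tail_sum x j) \<noteq> 0" for j
      proof
        assume "1 - exp (- tail_sum x j) = 0"
        then have "exp (- tail_sum x j) = exp 0"
          by simp
        moreover have "norm (tail_sum x j) < 1"
          using elim by blast
        then have "\<bar>Im (- tail_sum x j) - Im 0\<bar> < 2 * pi"
          using abs_Im_le_cmod[of "tail_sum x j"] pi_gt3 by (simp only: minus_complex.sel uminus_complex.sel) simp
        ultimately have "- tail_sum x j = 0"
          by (rule exp_complex_eqI[rotated])
        with nz show False
          by simp
      qed
      then have nz': "(\<Prod>j\<in>UNIV. 1 - exp (- tail_sum x j)) \<noteq> 0"
        by simp
      have "norm (?z $ j) < 1" for j
        using elim by simp
      moreover have "1 / (1 - ?z $ j) = exp (tail_sum x j)" for j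
        by (simp add: exp_minus divide_inverse)
      ultimately have "Li_shuffle (neg_tuple k) ?z =
          (\<Prod>j\<in>UNIV. 1 - exp (- tail_sum x j)) * (\<Sum>b\<in>B. c b * (\<Prod>j\<in>UNIV. exp (tail_sum x j) ^ Suc (b j)))"
        using Li_shuffle_neg_tuple[OF c, of ?z] by (simp only: vec_lambda_beta)
      then have "G x = (\<Sum>b\<in>B. c b * (\<Prod>j\<in>UNIV. exp (of_nat (\<Sum>i\<in>{..j}. Suc (b i)) * x $ j)))"
        unfolding G_def prod_exp_tail_sum using nz' by simp
      moreover have "((\<lambda>m. \<Sum>b\<in>B. c b * (\<Prod>j\<in>UNIV. of_nat (\<Sum>i\<in>{..j}. Suc (b i)) ^ m j * (x $ j ^ m j / fact (m j))))
          has_sum (\<Sum>b\<in>B. c b * (\<Prod>j\<in>UNIV. exp (of_nat (\<Sum>i\<in>{..j}. Suc (b i)) * x $ j)))) UNIV"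
        by (intro has_sum_finite_sum has_sum_cmult_right has_sum_exp_multi)
      ultimately show "((\<lambda>m. ?B m * (\<Prod>j\<in>UNIV. x $ j ^ m j / fact (m j))) has_sum G x) UNIV"
        by (simp only: prod.distrib sum_distrib_right mult.assoc)
    qed
  qed
  have unique: "C = ?B" if C: "\<forall>\<^sub>F x in nhds 0. expands C x" for C
  proof
    fix m
    have "\<forall>\<^sub>F x in nhds (0 :: (complex, 'r) vec). expands C x \<and> expands ?B x"
      using C exists by (rule eventually_conj)
    then obtain \<epsilon> where "\<epsilon> > 0" and \<epsilon>: "\<And>x. norm x < \<epsilon> \<Longrightarrow> expands C x \<and> expands ?B x"
      by (auto simp: eventually_nhds_metric)
    let ?a = "\<lambda>m. (C m - ?B m) / (\<Prod>j\<in>UNIV. fact (m j))"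
    have "?a m = 0"
    \<comment> \<open>The norm is at most the sum of the norms of the coordinates, so this box lies
      in the ball of radius \<open>\<epsilon>\<close>. Positive coordinates also make every tail sum
      nonzero, so both expansions hold throughout the box.\<close>
    proof (rule multi_power_series_zero[of UNIV "\<epsilon> / real CARD('r)" ?a])
      show "0 < \<epsilon> / real CARD('r)"
        using \<open>\<epsilon> > 0\<close> by simp
      fix y :: "'r \<Rightarrow> real"
      assume y: "\<And>i. 0 < y i \<and> y i < \<epsilon> / real CARD('r)"
      define x :: "(complex, 'r) vec" where "x = (\<chi> j. of_real (y j))"
      have "norm x \<le> (\<Sum>j\<in>UNIV. norm (x $ j))"
        unfolding norm_vec_def by (rule L2_set_le_sum) simp
      also have "\<dots> < (\<Sum>j\<in>(UNIV :: 'r set). \<epsilon> / real CARD('r))"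
        using y by (intro sum_strict_mono) (auto simp: x_def abs_of_pos)
      finally have "norm x < \<epsilon>"
        by simp
      moreover have "tail_sum x j \<noteq> 0" for j
      proof -
        have "(\<Sum>\<nu>\<in>{j..}. y \<nu>) > 0"
          using y by (intro sum_pos) auto
        moreover have "tail_sum x j = of_real (\<Sum>\<nu>\<in>{j..}. y \<nu>)"
          by (simp add: tail_sum_def x_def)
        ultimately show ?thesis
          by (simp only: of_real_eq_0_iff)
      qed
      ultimately have "((\<lambda>m. C m * (\<Prod>j\<in>UNIV. x $ j ^ m j / fact (m j)) +
          - 1 * (?B m * (\<Prod>j\<in>UNIV. x $ j ^ m j / fact (m j)))) has_sum (G x + - 1 * G x)) UNIV"
        using \<epsilon>[of x] unfolding expands_def by (intro has_sum_add has_sum_cmult_right) blast+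
      moreover have "C m * (\<Prod>j\<in>UNIV. x $ j ^ m j / fact (m j)) +
          - 1 * (?B m * (\<Prod>j\<in>UNIV. x $ j ^ m j / fact (m j))) = ?a m * (\<Prod>j\<in>UNIV. of_real (y j) ^ m j)" for m
        unfolding prod_dividef mult_minus1 diff_conv_add_uminus[symmetric] left_diff_distrib[symmetric]
        by (simp only: x_def vec_lambda_beta times_divide_eq_left times_divide_eq_right)
      ultimately show "((\<lambda>m. ?a m * (\<Prod>j\<in>UNIV. of_real (y j) ^ m j)) has_sum 0) {m. \<forall>i. i \<notin> UNIV \<longrightarrow> m i = 0}"
        by (simp only: UNIV_I not_True_eq_False simp_thms UNIV_def[symmetric] mult_minus1 add.right_inverse)
    qed auto
    then show "C m = ?B m"
      by simp
  qed
  have "multi_poly_Bernoulli (neg_tuple k) = ?B"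
    unfolding multi_poly_Bernoulli_def
    using exists unique unfolding expands_def G_def by (rule the_equality)
  then show ?thesis
    by (rule fun_cong)
qed

section \<open>Entire functions and the Gamma integral\<close>

lemma entire_fun_const: "entire_fun (\<lambda>_ :: complex^'r::{finite,linorder}. a)"
  unfolding entire_fun_def by (auto intro!: exI[of _ "\<lambda>_. 0"])

lemma entire_fun_add:
  fixes f g :: "complex^'r::{finite,linorder} \<Rightarrow> complex"
  assumes "entire_fun f" "entire_fun g"
  shows "entire_fun (\<lambda>s. f s + g s)"
  unfolding entire_fun_def
proof
  fix s
  from assms obtain D D' where
    "(f has_derivative D) (at s)" "\<forall>c v. D (c *s v) = c * D v"
    "(g has_derivative D') (at s)" "\<forall>c v. D' (c *s v) = c * D' v"
    unfolding entire_fun_def by blast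
  then show "\<exists>D. ((\<lambda>s. f s + g s) has_derivative D) (at s) \<and> (\<forall>c v. D (c *s v) = c * D v)"
    by (intro exI[of _ "\<lambda>v. D v + D' v"] conjI has_derivative_add) (simp_all add: distrib_left)
qed

lemma entire_fun_mult:
  fixes f g :: "complex^'r::{finite,linorder} \<Rightarrow> complex"
  assumes "entire_fun f" "entire_fun g"
  shows "entire_fun (\<lambda>s. f s * g s)"
  unfolding entire_fun_def
proof
  fix s
  from assms obtain D D' where
    "(f has_derivative D) (at s)" "\<forall>c v. D (c *s v) = c * D v"
    "(g has_derivative D') (at s)" "\<forall>c v. D' (c *s v) = c * D' v"
    unfolding entire_fun_def by blast
  then show "\<exists>D. ((\<lambda>s. f s * g s) has_derivative D) (at s) \<and> (\<forall>c v. D (c *s v) = c * D v)"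
    by (intro exI[of _ "\<lambda>v. f s * D' v + D v * g s"] conjI has_derivative_mult)
       (auto simp: distrib_left mult.left_commute mult.assoc)
qed

lemma entire_fun_sum:
  fixes f :: "'a \<Rightarrow> complex^'r::{finite,linorder} \<Rightarrow> complex"
  assumes "\<And>x. x \<in> A \<Longrightarrow> entire_fun (f x)"
  shows "entire_fun (\<lambda>s. \<Sum>x\<in>A. f x s)"
  using assms
proof (induction A rule: infinite_finite_induct)
  case (insert x A)
  then show ?case
    using entire_fun_add[of "f x" "\<lambda>s. \<Sum>x\<in>A. f x s"] by simp
qed (simp_all add: entire_fun_const)

lemma entire_fun_prod:
  fixes f :: "'a \<Rightarrow> complex^'r::{finite,linorder} \<Rightarrow> complex"
  assumes "\<And>x. x \<in> A \<Longrightarrow> entire_fun (f x)"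
  shows "entire_fun (\<lambda>s. \<Prod>x\<in>A. f x s)"
  using assms
proof (induction A rule: infinite_finite_induct)
  case (insert x A)
  then show ?case
    using entire_fun_mult[of "f x" "\<lambda>s. \<Prod>x\<in>A. f x s"] by simp
qed (simp_all add: entire_fun_const)

lemma entire_fun_powr:
  assumes "a \<noteq> 0"
  shows "entire_fun (\<lambda>s :: complex^'r::{finite,linorder}. a powr (- s $ j))"
  unfolding entire_fun_def
proof
  fix s :: "complex^'r::{finite,linorder}"
  have "((\<lambda>w. a powr (- w)) has_field_derivative - (a powr (- (s $ j)) * Ln a)) (at (s $ j))"
    using assms by (auto simp: powr_def intro!: derivative_eq_intros)
  then have "((\<lambda>w. a powr (- w)) has_derivative (\<lambda>h. - (a powr (- (s $ j)) * Ln a) * h)) (at (s $ j))"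
    by (simp only: has_field_derivative_def)
  from has_derivative_compose[OF bounded_linear.has_derivative[OF bounded_linear_vec_nth has_derivative_ident] this]
  show "\<exists>D. ((\<lambda>s. a powr (- s $ j)) has_derivative D) (at s) \<and> (\<forall>c v. D (c *s v) = c * D v)"
    by (intro exI[of _ "\<lambda>v. - (a powr (- (s $ j)) * Ln a) * v $ j"]) simp
qed

section \<open>The Gamma integral and its product over the coordinates\<close>

text \<open>Euler's integrand with rate \<open>a\<close>, extended by zero to the whole line so that
  an integral over the positive orthant becomes one over the full space.\<close>

definition gamma_kernel :: "real \<Rightarrow> complex \<Rightarrow> real \<Rightarrow> complex" where
  "gamma_kernel a z t = indicator {0<..} t *\<^sub>R (of_real t powr (z - 1) * of_real (exp (- (a * t))))"

text \<open>Euler's integral is known as an absolutely convergent Lebesgue and gauge integral; Borel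
  measurability of the kernel carries it over to \<open>lborel\<close>.\<close>

lemma gamma_kernel_1:
  assumes "Re z > 0"
  shows "integrable lborel (gamma_kernel 1 z)" "integral\<^sup>L lborel (gamma_kernel 1 z) = Gamma z"
proof -
  let ?f = "\<lambda>t. of_real t powr (z - 1) / complex_of_real (exp t)"
  have eq: "gamma_kernel 1 z = (\<lambda>t. indicator {0<..} t *\<^sub>R ?f t)"
    by (simp add: gamma_kernel_def exp_minus divide_inverse fun_eq_iff)
  have "continuous_on {0<..} (\<lambda>t. of_real t powr (z - 1) * complex_of_real (exp (- (1 * t))))"
    by (intro continuous_intros) (auto simp: complex_nonpos_Reals_iff)
  then have "(\<lambda>t. indicat_real {0<..} t *\<^sub>R (of_real t powr (z - 1) * complex_of_real (exp (- (1 * t)))))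
      \<in> borel_measurable borel"
    by (intro borel_measurable_continuous_on_indicator) auto
  then have meas: "gamma_kernel 1 z \<in> borel_measurable lborel"
    by (simp add: gamma_kernel_def[abs_def])
  have "integrable lebesgue (gamma_kernel 1 z)"
    using absolutely_integrable_Gamma_integral'[OF assms] unfolding set_integrable_def eq .
  then show int: "integrable lborel (gamma_kernel 1 z)"
    using integrable_completion[OF meas] by simp
  then have "(LINT t:{0<..}|lborel. ?f t) = integral {0<..} ?f"
    by (intro set_borel_integral_eq_integral) (simp add: set_integrable_def eq)
  also have "\<dots> = Gamma z"
    using Gamma_integral_complex'[OF assms] by (rule integral_unique)
  finally show "integral\<^sup>L lborel (gamma_kernel 1 z) = Gamma z"
    by (simp add: set_lebesgue_integral_def eq)
qed

text \<open>Substitution of \<open>a * t\<close> for \<open>t\<close>: the kernel contributes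
  \<open>a powr (z - 1)\<close> and the measure \<open>a\<close>, together
  \<open>a powr z\<close>.\<close>

lemma gamma_kernel:
  assumes "Re z > 0" "a > 0"
  shows "integrable lborel (gamma_kernel a z)"
    "integral\<^sup>L lborel (gamma_kernel a z) = Gamma z * of_real a powr (- z)"
proof -
  have "of_real (a * t) powr (z - 1) = of_real a powr (z - 1) * of_real t powr (z - 1)" if "t > 0" for t
    using assms that by (simp add: powr_times_real)
  then have scale: "gamma_kernel 1 z (0 + a * t) = of_real a powr (z - 1) * gamma_kernel a z t" for t
    using assms by (auto simp: gamma_kernel_def zero_less_mult_iff split: split_indicator)
  have nz: "complex_of_real a powr (z - 1) \<noteq> 0"
    using assms by simp
  have "integrable lborel (\<lambda>t. gamma_kernel 1 z (0 + a * t))"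
    using assms by (intro lborel_integrable_real_affine gamma_kernel_1) auto
  then have "integrable lborel (\<lambda>t. inverse (of_real a powr (z - 1)) * gamma_kernel 1 z (0 + a * t))"
    by (rule integrable_mult_right)
  moreover have "inverse (of_real a powr (z - 1)) * gamma_kernel 1 z (0 + a * t) = gamma_kernel a z t" for t
    unfolding scale using nz by (simp add: field_simps)
  ultimately show "integrable lborel (gamma_kernel a z)"
    by (simp only:)
  have "Gamma z = \<bar>a\<bar> *\<^sub>R (LINT t|lborel. gamma_kernel 1 z (0 + a * t))"
    unfolding gamma_kernel_1(2)[OF assms(1), symmetric]
    using assms by (intro lborel_integral_real_affine) auto
  also have "\<dots> = (of_real a * of_real a powr (z - 1)) * integral\<^sup>L lborel (gamma_kernel a z)"
    unfolding scale using assms nz by (simp add: scaleR_conv_of_real)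
  also have "of_real a * of_real a powr (z - 1) = complex_of_real a powr z"
    using assms by (simp add: powr_diff)
  finally show "integral\<^sup>L lborel (gamma_kernel a z) = Gamma z * of_real a powr (- z)"
    using assms by (simp add: powr_minus field_simps)
qed

text \<open>Fubini for a product of one-variable functions. \<open>lborel\<close> is the image under
  \<open>?h\<close> of a product measure indexed by \<open>Basis\<close>, so the index set has to be
  translated to \<open>'r\<close> through the axis vectors.\<close>

lemma lborel_vec_prod:
  fixes f :: "'r::finite \<Rightarrow> real \<Rightarrow> complex"
  assumes "\<And>j. integrable lborel (f j)"
  shows "integrable lborel (\<lambda>t :: real^'r. \<Prod>j\<in>UNIV. f j (t $ j))"
    and "(\<integral>t. (\<Prod>j\<in>UNIV. f j ((t :: real^'r) $ j)) \<partial>lborel) = (\<Prod>j\<in>UNIV. integral\<^sup>L lborel (f j))"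
proof -
  interpret product_sigma_finite "\<lambda>_ :: real^'r. lborel :: real measure"
    by standard
  let ?e = "\<lambda>j :: 'r. axis j (1 :: real)"
  let ?ix = "inv ?e"
  let ?h = "\<lambda>x. \<Sum>b\<in>(Basis :: (real^'r) set). x b *\<^sub>R b"
  have inj: "inj ?e"
    by (auto simp: inj_def axis_eq_axis)
  have Basis: "(Basis :: (real^'r) set) = range ?e"
    by (auto simp: Basis_vec_def)
  have nth: "?h x $ j = x (?e j)" for x j
  proof -
    have "?h x \<bullet> ?e j = x (?e j)"
      by (rule inner_sum_left_Basis) (simp add: Basis)
    then show ?thesis
      by (simp add: inner_axis)
  qed
  have reindex: "(\<Prod>b\<in>Basis. g (?ix b) b) = (\<Prod>j\<in>UNIV. g j (?e j))" for g :: "'r \<Rightarrow> real^'r \<Rightarrow> complex"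
    unfolding Basis by (subst prod.reindex[OF inj]) (simp add: inv_f_f[OF inj])
  have [measurable]: "f j \<in> borel_measurable borel" for j
    using assms[of j] by (simp add: borel_measurable_integrable)
  have meas: "(\<lambda>t :: real^'r. \<Prod>j\<in>UNIV. f j (t $ j)) \<in> borel_measurable borel"
    by measurable
  have h: "?h \<in> measurable (\<Pi>\<^sub>M b\<in>Basis. lborel) borel"
    by measurable
  have prod_eq: "(\<Prod>j\<in>UNIV. f j (?h x $ j)) = (\<Prod>b\<in>Basis. f (?ix b) (x b))" for x
    unfolding nth by (rule reindex[of "\<lambda>j b. f j (x b)", symmetric])
  show "integrable lborel (\<lambda>t :: real^'r. \<Prod>j\<in>UNIV. f j (t $ j))"
    unfolding lborel_eq[where 'a = "real^'r"] integrable_distr_eq[OF h meas] prod_eq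
    using assms by (intro product_integrable_prod) auto
  have "(\<integral>t. (\<Prod>j\<in>UNIV. f j ((t :: real^'r) $ j)) \<partial>lborel) = (\<Prod>b\<in>Basis. integral\<^sup>L lborel (f (?ix b)))"
    unfolding lborel_eq[where 'a = "real^'r"] integral_distr[OF h meas] prod_eq
    using assms by (intro product_integral_prod) auto
  then show "(\<integral>t. (\<Prod>j\<in>UNIV. f j ((t :: real^'r) $ j)) \<partial>lborel) = (\<Prod>j\<in>UNIV. integral\<^sup>L lborel (f j))"
    unfolding reindex[of "\<lambda>j _. integral\<^sup>L lborel (f j)"] .
qed

section \<open>The eta function\<close>

text \<open>With \<open>z = 1 - exp T\<close> the factors \<open>z\<close> cancel and
  \<open>1 / (1 - z)\<close> is \<open>exp (- T)\<close>, so the variables separate into Gamma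
  kernels. Off the orthant some kernel vanishes, hence the identity holds for every
  \<open>t\<close>.\<close>

lemma eta_integrand_eq:
  fixes k :: "'r::{finite,linorder} \<Rightarrow> nat"
  defines "K \<equiv> \<lambda>i. \<Sum>\<nu>\<in>{i..}. k \<nu>"
  assumes c: "\<And>n. (\<Prod>j\<in>UNIV. of_nat (\<Sum>\<nu>\<in>{..j}. Suc (n \<nu>)) ^ k j) = (\<Sum>b\<in>{..K}. c b * binom_prod b n)"
  shows "indicator {t. \<forall>j. 0 < t $ j} t *\<^sub>R eta_integrand k s t =
    (\<Sum>b\<in>{..K}. c b * (\<Prod>j\<in>UNIV. gamma_kernel (of_nat (\<Sum>i\<in>{..j}. Suc (b i))) (s $ j) (t $ j)))"
proof (cases "\<forall>j. 0 < t $ j")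
  case True
  let ?z = "\<chi> j. 1 - complex_of_real (exp (tail_sum t j))"
  have "0 < tail_sum t j" for j
    unfolding tail_sum_def using True by (intro sum_pos) auto
  then have "1 - complex_of_real (exp (tail_sum t j)) \<noteq> 0" for j
    using one_less_exp_iff[of "tail_sum t j"] by (metis eq_iff_diff_eq_0 less_irrefl of_real_1 of_real_eq_iff)
  then have nz: "(\<Prod>j\<in>UNIV. 1 - complex_of_real (exp (tail_sum t j))) \<noteq> 0"
    by simp
  \<comment> \<open>The sign is moved inside \<open>tail_sum\<close> so that
    \<open>prod_exp_tail_sum\<close> applies at \<open>- t\<close>.\<close>
  have inv: "1 / (1 - ?z $ j) = of_real (exp (tail_sum (- t) j))" for j
    by (simp add: tail_sum_minus exp_minus divide_inverse)
  have "?z $ j \<noteq> 1" for j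
    by (simp del: of_real_exp)
  from Li_shuffle_rat_eq[OF c[unfolded K_def], of ?z, OF this, folded K_def, unfolded inv]
  have "Li_shuffle_rat k ?z / (\<Prod>j\<in>UNIV. 1 - of_real (exp (tail_sum t j))) =
      (\<Sum>b\<in>{..K}. c b * (\<Prod>j\<in>UNIV. of_real (exp (tail_sum (- t) j)) ^ Suc (b j)))"
    using nz by (simp only: vec_lambda_beta nonzero_mult_div_cancel_left not_False_eq_True)
  also have "\<dots> = (\<Sum>b\<in>{..K}. c b * of_real (\<Prod>j\<in>UNIV. exp (tail_sum (- t) j) ^ Suc (b j)))"
    by (simp only: of_real_prod of_real_power)
  also have "\<dots> = (\<Sum>b\<in>{..K}. c b *
      (\<Prod>j\<in>UNIV. of_real (exp (- (of_nat (\<Sum>i\<in>{..j}. Suc (b i)) * t $ j)))))"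
    unfolding prod_exp_tail_sum by (simp only: of_real_prod vector_uminus_component mult_minus_right)
  finally have "eta_integrand k s t = (\<Sum>b\<in>{..K}. c b *
      ((\<Prod>j\<in>UNIV. of_real (t $ j) powr (s $ j - 1)) *
       (\<Prod>j\<in>UNIV. of_real (exp (- (of_nat (\<Sum>i\<in>{..j}. Suc (b i)) * t $ j))))))"
    unfolding eta_integrand_def by (simp only: sum_distrib_left mult.left_commute)
  then show ?thesis
    using True unfolding gamma_kernel_def prod.distrib[symmetric]
    by (simp only: indicator_simps mem_Collect_eq greaterThan_iff if_True scaleR_one simp_thms)
next
  case False
  then obtain i where "\<not> 0 < t $ i"
    by blast
  then have "gamma_kernel a z (t $ i) = 0" for a z
    by (simp add: gamma_kernel_def)
  then have "(\<Prod>j\<in>UNIV. gamma_kernel (a j) (s $ j) (t $ j)) = 0" for a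
    by (intro prod_zero) auto
  then show ?thesis
    using False by (simp only: indicator_simps mem_Collect_eq if_False scaleR_zero_left mult_zero_right
        sum.neutral_const not_False_eq_True)
qed

theorem theorem5p7:
  fixes k :: "'r::{finite,linorder} \<Rightarrow> nat"
  shows "(\<forall>s :: complex^'r::{finite,linorder}. (\<forall>j. Re (s $ j) > 0) \<longrightarrow>
            set_integrable lborel {t. \<forall>j. 0 < t $ j} (eta_integrand k s)) \<and>
         (\<exists>F :: complex^'r::{finite,linorder} \<Rightarrow> complex. entire_fun F \<and>
            (\<forall>s. (\<forall>j. Re (s $ j) > 0) \<longrightarrow> F s = eta k s) \<and>
            (\<forall>m. F (neg_tuple m) = multi_poly_Bernoulli (neg_tuple k) m))"
proof -
  define K where "K = (\<lambda>i. \<Sum>\<nu>\<in>{i..}. k \<nu>)"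
  obtain c where c: "\<And>n. (\<Prod>j\<in>UNIV. of_nat (\<Sum>\<nu>\<in>{..j}. Suc (n \<nu>)) ^ k j) =
      (\<Sum>b\<in>{..K}. c b * binom_prod b n)"
    unfolding K_def using prod_partial_sums_in_span[of k] by (rule binom_spanE) blast
  define e where "e = (\<lambda>(b :: 'r \<Rightarrow> nat) j. \<Sum>i\<in>{..j}. Suc (b i))"
  \<comment> \<open>Positivity gives convergence of the Gamma integrals, and a nonzero base both for
    holomorphy of the powers and for their values at \<open>-m\<close>.\<close>
  have e_pos: "e b j > 0" for b j
    unfolding e_def by (intro sum_pos) auto
  have e: "(\<Sum>i\<in>{..j}. Suc (b i)) = e b j" for b j
    by (simp add: e_def)
  note integrand = eta_integrand_eq[OF c[unfolded K_def], folded K_def, unfolded e]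
  \<comment> \<open>The Gamma integral of rate \<open>e b j\<close> is \<open>Gamma (s $ j)\<close>
    times this power, so dividing the integral by the Gamma factors leaves \<open>F\<close>.\<close>
  define F where "F = (\<lambda>s :: (complex, 'r) vec. \<Sum>b\<in>{..K}. c b * (\<Prod>j\<in>UNIV. of_nat (e b j) powr (- s $ j)))"
  have ker: "integrable lborel (gamma_kernel (of_nat (e b j)) (s $ j))"
    "integral\<^sup>L lborel (gamma_kernel (of_nat (e b j)) (s $ j)) = Gamma (s $ j) * of_nat (e b j) powr (- s $ j)"
    if "\<forall>j. Re (s $ j) > 0" for b j and s :: "(complex, 'r) vec"
    using gamma_kernel[of "s $ j" "of_nat (e b j)"] that e_pos by simp_all
  have "set_integrable lborel {t. \<forall>j. 0 < t $ j} (eta_integrand k s)" if "\<forall>j. Re (s $ j) > 0" for s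
    unfolding set_integrable_def integrand
    by (intro Bochner_Integration.integrable_sum integrable_mult_right lborel_vec_prod(1) ker(1) that)
  moreover have "entire_fun F"
    unfolding F_def
    by (intro entire_fun_sum entire_fun_mult entire_fun_const entire_fun_prod entire_fun_powr)
       (use e_pos in \<open>simp add: neq0_conv\<close>)
  moreover have "F s = eta k s" if s: "\<forall>j. Re (s $ j) > 0" for s
  proof -
    \<comment> \<open>By convention \<open>Gamma\<close> is 0 exactly at its poles, the nonpositive
      integers, which a positive real part excludes.\<close>
    have "Gamma (s $ j) \<noteq> 0" for j
      using s by (auto simp: Gamma_eq_zero_iff elim!: nonpos_Ints_cases dest!: spec[of _ j])
    then have nz: "(\<Prod>j\<in>UNIV. Gamma (s $ j)) \<noteq> 0"
      by simp
    have "(LINT t:{t. \<forall>j. 0 < t $ j}|lborel. eta_integrand k s t) =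
        (\<Sum>b\<in>{..K}. c b * (\<Prod>j\<in>UNIV. Gamma (s $ j) * of_nat (e b j) powr (- s $ j)))"
      unfolding set_lebesgue_integral_def integrand ker(2)[OF s, symmetric]
      by (subst Bochner_Integration.integral_sum)
         (intro integrable_mult_right lborel_vec_prod(1) ker(1) s,
          simp only: integral_mult_right_zero lborel_vec_prod(2)[OF ker(1)[OF s]])
    also have "\<dots> = (\<Prod>j\<in>UNIV. Gamma (s $ j)) * F s"
      unfolding F_def by (simp only: prod.distrib sum_distrib_left mult.left_commute)
    finally show ?thesis
      unfolding eta_def using nz by simp
  qed
  moreover have "F (neg_tuple m) = multi_poly_Bernoulli (neg_tuple k) m" for m
  proof -
    \<comment> \<open>At \<open>s = -m\<close> the complex powers become the ordinary powers in the
      Taylor coefficients, including the case \<open>m j = 0\<close>.\<close>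
    have "of_nat (e b j) powr (- neg_tuple m $ j) = (of_nat (e b j) :: complex) ^ m j" for b j
      unfolding neg_tuple_def vec_lambda_beta minus_minus
      using e_pos[of b j] by (subst powr_nat') auto
    then show ?thesis
      unfolding F_def multi_poly_Bernoulli_neg_tuple[OF c] e by (simp only:)
  qed
  ultimately show ?thesis
    by blast
qed

end
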